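(* Let $\gamma,n\in\mathbb{N}_0$ and $\beta,\lambda\in\mathbb{N}$. For $k\in\{0,1,\dots,n\}$ consider barred preferential arrangements of $X_n=\{1,\dots,n\}$ with $\lambda-1$ bars (so $\lambda$ sections) in which: the first section has $\gamma+k\beta$ labelled compartments, organised as $\gamma$ compartments together with $k$ distinct labelled parts each consisting of $\beta$ labelled compartments, its elements being distributed into these compartments (each element of the first section placed in exactly one compartment), with the requirement that none of the $k$ parts is empty; and each of the remaining $\lambda-1$ sections is a (possibly empty) preferential arrangement whose blocks each have $\beta$ labelled compartments (each element of such a section receives a label from $\{1,\dots,\beta\}$). The total number of such arrangements, summed over $k=0,1,\dots,n$, equals $$\sum_{k=0}^{n}\sum_{s=0}^{k}(-1)^{k-s}\binom{k}{s}H_n(\lambda-1,\beta,\gamma+\beta s),$$ where $H_n(\lambda,\beta,\gamma)$ denotes the coefficient of $\frac{x^n}{n!}$ in $\frac{e^{\gamma x}}{(2-e^{\beta x})^{\lambda}}$.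
   Context: A preferential arrangement of a finite set is an ordered set partition (sequence of non-empty disjoint blocks covering the set). A barred preferential arrangement with $\xi$ bars consists of $\xi$ identical bars creating $\xi+1$ ordered sections, with the elements distributed among the sections and each section carrying a (possibly empty) preferential arrangement. For $\lambda-1=0$ there are no bars and only the first section. Convention $0^0=1$. *)

theory Defs
  imports
    Complex_Main
    "HOL-Library.FuncSet"
    "HOL-Library.Disjoint_Sets"
    "HOL-Computational_Algebra.Formal_Power_Series"
begin

definition preferential_arrangements :: "'a set \<Rightarrow> 'a set list set" where
  "preferential_arrangements A = {Bs. distinct Bs \<and> partition_on A (set Bs)}"

text \<open>Identical bars are determined by the ordered sections they delimit. Sections may be
  empty, and several of them may be empty at once, so a list of sections need not be distinct.\<close>

definition barred_sections :: "nat \<Rightarrow> 'a set \<Rightarrow> 'a set list set" where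
  "barred_sections \<xi> X =
     {Ss. length Ss = \<xi> + 1 \<and> disjoint_family_on (nth Ss) {..<length Ss} \<and> \<Union>(set Ss) = X}"

text \<open>\<open>Inl c\<close> is one of the \<open>\<gamma>\<close> compartments outside the parts; \<open>Inr (j, b)\<close> is compartment \<open>b\<close>
  of part \<open>j\<close>.\<close>

definition compartments :: "nat \<Rightarrow> nat \<Rightarrow> nat \<Rightarrow> (nat + nat \<times> nat) set" where
  "compartments \<gamma> \<beta> k = {1..\<gamma>} <+> ({1..k} \<times> {1..\<beta>})"

definition first_section_arrangements ::
    "nat \<Rightarrow> nat \<Rightarrow> nat \<Rightarrow> 'a set \<Rightarrow> ('a \<Rightarrow> nat + nat \<times> nat) set" where
  "first_section_arrangements \<gamma> \<beta> k A =
     {f \<in> A \<rightarrow>\<^sub>E compartments \<gamma> \<beta> k. \<forall>j\<in>{1..k}. \<exists>x\<in>A. \<exists>b\<in>{1..\<beta>}. f x = Inr (j, b)}"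

text \<open>The second component records, for each element, in which of the \<open>\<beta>\<close> compartments of
  its own block it lies.\<close>

definition other_section_arrangements ::
    "nat \<Rightarrow> 'a set \<Rightarrow> ('a set list \<times> ('a \<Rightarrow> nat)) set" where
  "other_section_arrangements \<beta> A = preferential_arrangements A \<times> (A \<rightarrow>\<^sub>E {1..\<beta>})"

definition barred_arrangements ::
    "nat \<Rightarrow> nat \<Rightarrow> nat \<Rightarrow> nat \<Rightarrow> 'a set \<Rightarrow>
      ('a set list \<times> ('a \<Rightarrow> nat + nat \<times> nat) \<times> ('a set list \<times> ('a \<Rightarrow> nat)) list) set" where
  "barred_arrangements \<xi> \<beta> \<gamma> k X =
     {(Ss, f, gs). Ss \<in> barred_sections \<xi> X \<and>
        f \<in> first_section_arrangements \<gamma> \<beta> k (hd Ss) \<and>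
        list_all2 (\<lambda>A g. g \<in> other_section_arrangements \<beta> A) (tl Ss) gs}"

definition H :: "nat \<Rightarrow> nat \<Rightarrow> nat \<Rightarrow> nat \<Rightarrow> real" where
  "H n l \<beta> \<gamma> = fact n * fps_nth (fps_exp (real \<gamma>) / (2 - fps_exp (real \<beta>)) ^ l) n"

text \<open>The arrangements form a finite set, so \<open>card\<close> is a genuine count.\<close>

lemma finite_preferential_arrangements:
  assumes "finite A"
  shows "finite (preferential_arrangements A)"
proof (rule finite_subset)
  show "preferential_arrangements A \<subseteq> {Bs. set Bs \<subseteq> Pow A \<and> distinct Bs}"
    by (auto simp: preferential_arrangements_def partition_on_def)
  show "finite {Bs. set Bs \<subseteq> Pow A \<and> distinct Bs}"
    using assms by (intro finite_subset_distinct) auto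
qed

lemma finite_list_all2_image:
  assumes "\<And>x. x \<in> set xs \<Longrightarrow> finite {y. P x y}"
  shows "finite {ys. list_all2 P xs ys}"
  using assms
proof (induction xs)
  case Nil
  have "{ys. list_all2 P [] ys} = {[]}" by auto
  then show ?case by simp
next
  case (Cons x xs)
  have "{ys. list_all2 P (x # xs) ys} =
      (\<lambda>(y, ys). y # ys) ` ({y. P x y} \<times> {ys. list_all2 P xs ys})"
    by (auto simp: list_all2_Cons1)
  with Cons show ?case by auto
qed

lemma finite_barred_arrangements:
  assumes X: "finite X"
  shows "finite (barred_arrangements \<xi> \<beta> \<gamma> k X)"
proof -
  let ?F = "\<lambda>Ss. first_section_arrangements \<gamma> \<beta> k (hd Ss) \<times>
    {gs. list_all2 (\<lambda>A g. g \<in> other_section_arrangements \<beta> A) (tl Ss) gs}"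
  have "barred_sections \<xi> X \<subseteq> {Ss. set Ss \<subseteq> Pow X \<and> length Ss = \<xi> + 1}"
    by (auto simp: barred_sections_def)
  moreover have "finite {Ss. set Ss \<subseteq> Pow X \<and> length Ss = \<xi> + 1}"
    using X by (intro finite_lists_length_eq) auto
  ultimately have S: "finite (barred_sections \<xi> X)"
    by (rule finite_subset)
  have F: "finite (?F Ss)" if "Ss \<in> barred_sections \<xi> X" for Ss
  proof -
    have ne: "Ss \<noteq> []" and sub: "\<And>A. A \<in> set Ss \<Longrightarrow> finite A"
      using that X by (auto simp: barred_sections_def intro: finite_subset)
    have "finite (hd Ss \<rightarrow>\<^sub>E compartments \<gamma> \<beta> k)"
      using ne sub by (intro finite_PiE) (auto simp: compartments_def)
    then have "finite (first_section_arrangements \<gamma> \<beta> k (hd Ss))"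
      by (simp add: first_section_arrangements_def)
    moreover have "finite (other_section_arrangements \<beta> A)" if "A \<in> set (tl Ss)" for A
    proof -
      have "finite A" using that ne sub by (meson list.set_sel(2))
      then show ?thesis
        unfolding other_section_arrangements_def
        by (intro finite_cartesian_product finite_preferential_arrangements finite_PiE) auto
    qed
    ultimately show ?thesis
      by (intro finite_cartesian_product finite_list_all2_image) simp_all
  qed
  have "barred_arrangements \<xi> \<beta> \<gamma> k X = Sigma (barred_sections \<xi> X) ?F"
    by (auto simp: barred_arrangements_def)
  then show ?thesis
    using finite_SigmaI[OF S F] by simp
qed

end

theory Submission imports Defs begin

text \<open>Each kind of section has an exponential generating function, and distributing the elements
  of \<open>X\<close> among several sections multiplies these functions. A part of the first section that must be
  non-empty contributes \<open>e\<^sup>\<beta>\<^sup>x - 1\<close>, so the first section has generating function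
  \<open>e\<^sup>\<gamma>\<^sup>x (e\<^sup>\<beta>\<^sup>x - 1)\<^sup>k\<close>. Splitting off the first block of a
  preferential arrangement shows that every other section contributes a series \<open>G\<close> with
  \<open>G = 1 + (e\<^sup>\<beta>\<^sup>x - 1) G\<close>. Expanding the \<open>k\<close>-th power by the binomial theorem gives the
  alternating sum, for each \<open>k\<close> separately.\<close>

section \<open>Exponential generating functions of set weights\<close>

text \<open>A weight can satisfy this only if it depends on nothing but the cardinality of a finite
  set; building that invariance in lets a product of series stand for a sum over subsets. Infinite
  sets are left unconstrained.\<close>

definition has_egf :: "('a set \<Rightarrow> real) \<Rightarrow> real fps \<Rightarrow> bool" where
  "has_egf w F \<longleftrightarrow> (\<forall>A. finite A \<longrightarrow> w A = fact (card A) * fps_nth F (card A))"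

lemma has_egfD: "has_egf w F \<Longrightarrow> finite A \<Longrightarrow> w A = fact (card A) * fps_nth F (card A)"
  by (simp add: has_egf_def)

lemma has_egf_cong:
  assumes "\<And>A. finite A \<Longrightarrow> w A = v A" and "has_egf v F"
  shows "has_egf w F"
  using assms by (simp add: has_egf_def)

lemma sum_Pow_card:
  fixes f :: "nat \<Rightarrow> real"
  assumes "finite X"
  shows "(\<Sum>A\<in>Pow X. f (card A)) = (\<Sum>j=0..card X. real (card X choose j) * f j)"
proof -
  have "(\<Sum>A\<in>Pow X. f (card A)) = (\<Sum>j=0..card X. \<Sum>A\<in>{A\<in>Pow X. card A = j}. f (card A))"
    using assms by (intro sum.group[symmetric]) (auto intro: card_mono)
  also have "\<dots> = (\<Sum>j=0..card X. real (card X choose j) * f j)"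
    using n_subsets[OF assms] by (intro sum.cong) auto
  finally show ?thesis .
qed

text \<open>The binomial coefficient counting subsets of a given size cancels against the factorials
  and leaves a Cauchy product. The hypothesis concerns only subsets of this one \<open>X\<close>, so
  the rule also works inside an induction, where a weight is known only on smaller sets.\<close>

lemma sum_Pow_egf_mult:
  fixes F G :: "real fps"
  assumes X: "finite X"
    and h: "\<And>A. A \<subseteq> X \<Longrightarrow> h A =
      (fact (card A) * fps_nth F (card A)) * (fact (card (X - A)) * fps_nth G (card (X - A)))"
  shows "(\<Sum>A\<in>Pow X. h A) = fact (card X) * fps_nth (F * G) (card X)"
proof -
  let ?n = "card X"
  have "(\<Sum>A\<in>Pow X. h A) = (\<Sum>A\<in>Pow X. (fact (card A) * fps_nth F (card A)) *
      (fact (?n - card A) * fps_nth G (?n - card A)))"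
    using X by (intro sum.cong refl) (auto simp: h card_Diff_subset finite_subset)
  also have "\<dots> = (\<Sum>j=0..?n. real (?n choose j) * ((fact j * fps_nth F j) *
      (fact (?n - j) * fps_nth G (?n - j))))"
    by (rule sum_Pow_card[OF X])
  also have "\<dots> = (\<Sum>j=0..?n. fact ?n * (fps_nth F j * fps_nth G (?n - j)))"
    by (intro sum.cong refl) (simp add: binomial_fact)
  finally show ?thesis
    by (simp add: fps_mult_nth sum_distrib_left)
qed

lemma has_egf_mult:
  assumes "has_egf w F" and "has_egf v G"
  shows "has_egf (\<lambda>X. \<Sum>A\<in>Pow X. w A * v (X - A)) (F * G)"
  unfolding has_egf_def
proof (intro allI impI)
  fix X :: "'a set" assume X: "finite X"
  show "(\<Sum>A\<in>Pow X. w A * v (X - A)) = fact (card X) * fps_nth (F * G) (card X)"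
  proof (rule sum_Pow_egf_mult[OF X])
    fix A assume "A \<subseteq> X"
    then have "finite A" "finite (X - A)" using X by (auto intro: finite_subset)
    then show "w A * v (X - A) = (fact (card A) * fps_nth F (card A)) *
        (fact (card (X - A)) * fps_nth G (card (X - A)))"
      using assms by (simp add: has_egfD)
  qed
qed

text \<open>Valid for \<open>c = 0\<close> too, where \<open>0 ^ 0 = 1\<close> agrees with
  \<open>fps_exp 0 = 1\<close>; this covers a first section with
  \<open>\<gamma> = 0\<close>.\<close>

lemma has_egf_power_card: "has_egf (\<lambda>A. c ^ card A) (fps_exp c)"
  by (simp add: has_egf_def)

lemma has_egf_power_card_nonempty:
  "has_egf (\<lambda>A. if A = {} then 0 else c ^ card A) (fps_exp c - 1)"
  by (auto simp: has_egf_def card_gt_0_iff)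

section \<open>The first section\<close>

text \<open>Once the set \<open>B\<close> of elements lying in the last part is fixed, the
  compartments chosen inside that part and the arrangement of the other elements are independent.
  The last part is non-empty exactly because \<open>B\<close> is.\<close>

lemma fibre_first_section_arrangements:
  fixes \<gamma> \<beta> k :: nat
  assumes B: "B \<subseteq> A" "B \<noteq> {}"
  shows "bij_betw (\<lambda>(g, h) x. if x \<in> B then Inr (Suc k, g x) else h x)
    ((B \<rightarrow>\<^sub>E {1..\<beta>}) \<times> first_section_arrangements \<gamma> \<beta> k (A - B))
    {f \<in> first_section_arrangements \<gamma> \<beta> (Suc k) A. {x \<in> A. \<exists>b. f x = Inr (Suc k, b)} = B}"
    (is "bij_betw ?glue ?P ?Q")
\<comment> \<open>The inverse map keeps the compartment number on \<open>B\<close> and forgets the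
  part index. \<open>restrict\<close> supplies the value \<open>undefined\<close> that extensional
  functions need outside their domains.\<close>
proof (rule bij_betw_byWitness[where f' = "\<lambda>f. (restrict (\<lambda>x. snd (projr (f x))) B, restrict f (A - B))"])
  show "\<forall>p\<in>?P. (restrict (\<lambda>x. snd (projr (?glue p x))) B, restrict (?glue p) (A - B)) = p"
    by (auto simp: first_section_arrangements_def fun_eq_iff PiE_def extensional_def)
  show "\<forall>f\<in>?Q. ?glue (restrict (\<lambda>x. snd (projr (f x))) B, restrict f (A - B)) = f"
    using B by (auto simp: first_section_arrangements_def fun_eq_iff PiE_def extensional_def)
  show "?glue ` ?P \<subseteq> ?Q"
  proof (clarify, intro CollectI conjI)
    fix g h assume g: "g \<in> B \<rightarrow>\<^sub>E {1..\<beta>}" and h: "h \<in> first_section_arrangements \<gamma> \<beta> k (A - B)"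
    let ?f = "\<lambda>x. if x \<in> B then Inr (Suc k, g x) else h x"
    have h': "h x \<in> compartments \<gamma> \<beta> k" if "x \<in> A" "x \<notin> B" for x
      using h that by (auto simp: first_section_arrangements_def)
    have surj: "\<exists>x\<in>A. \<exists>b\<in>{1..\<beta>}. ?f x = Inr (j, b)" if "j \<in> {1..Suc k}" for j
    proof (cases "j = Suc k")
      case True
      obtain x where "x \<in> B" using B by auto
      then show ?thesis using True B g by (intro bexI[of _ x] bexI[of _ "g x"]) auto
    next
      case False
      then have "j \<in> {1..k}" using that by auto
      then obtain x b where "x \<in> A - B" "b \<in> {1..\<beta>}" "h x = Inr (j, b)"
        using h unfolding first_section_arrangements_def by blast
      then show ?thesis by (intro bexI[of _ x] bexI[of _ b]) auto
    qed
    have "?f \<in> A \<rightarrow>\<^sub>E compartments \<gamma> \<beta> (Suc k)"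
    proof (rule PiE_I)
      fix x assume "x \<in> A"
      then show "?f x \<in> compartments \<gamma> \<beta> (Suc k)"
        using g h'[of x] by (auto simp: compartments_def)
    next
      fix x assume "x \<notin> A"
      then show "?f x = undefined"
        using B h by (auto simp: first_section_arrangements_def PiE_def extensional_def)
    qed
    then show "?f \<in> first_section_arrangements \<gamma> \<beta> (Suc k) A"
      using surj by (auto simp: first_section_arrangements_def)
    \<comment> \<open>Values of \<open>h\<close> have part index at most \<open>k\<close>, so only
      elements of \<open>B\<close> land in part \<open>Suc k\<close>.\<close>
    show "{x \<in> A. \<exists>b. ?f x = Inr (Suc k, b)} = B"
      using B h' by (force simp: compartments_def)
  qed
  show "(\<lambda>f. (restrict (\<lambda>x. snd (projr (f x))) B, restrict f (A - B))) ` ?Q \<subseteq> ?P"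
  proof (rule image_subsetI)
    fix f assume "f \<in> ?Q"
    then have f: "f \<in> first_section_arrangements \<gamma> \<beta> (Suc k) A"
      and Bdef: "B = {x \<in> A. \<exists>b. f x = Inr (Suc k, b)}"
      by auto
    have fx: "f x \<in> compartments \<gamma> \<beta> (Suc k)" if "x \<in> A" for x
      using f that by (auto simp: first_section_arrangements_def)
    have "snd (projr (f x)) \<in> {1..\<beta>}" if "x \<in> B" for x
      using fx[of x] that Bdef by (auto simp: compartments_def)
    then have "restrict (\<lambda>x. snd (projr (f x))) B \<in> B \<rightarrow>\<^sub>E {1..\<beta>}"
      by simp
    moreover have "f x \<in> compartments \<gamma> \<beta> k" if "x \<in> A - B" for x
      using fx[of x] that Bdef by (auto simp: compartments_def le_Suc_eq)
    moreover have "\<exists>x\<in>A - B. \<exists>b\<in>{1..\<beta>}. f x = Inr (j, b)" if "j \<in> {1..k}" for j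
    proof -
      have "j \<in> {1..Suc k}" using that by auto
      then obtain x b where "x \<in> A" "b \<in> {1..\<beta>}" "f x = Inr (j, b)"
        using f unfolding first_section_arrangements_def by blast
      then show ?thesis using that Bdef by (intro bexI[of _ x] bexI[of _ b]) auto
    qed
    ultimately show "(restrict (\<lambda>x. snd (projr (f x))) B, restrict f (A - B)) \<in> ?P"
      by (auto simp: first_section_arrangements_def)
  qed
qed

lemma finite_first_section_arrangements:
  assumes "finite A"
  shows "finite (first_section_arrangements \<gamma> \<beta> k A)"
proof -
  have "finite (A \<rightarrow>\<^sub>E compartments \<gamma> \<beta> k)"
    using assms by (intro finite_PiE) (auto simp: compartments_def)
  then show ?thesis
    by (simp add: first_section_arrangements_def)
qed

text \<open>Arrangements are sorted by the content \<open>B\<close> of the last part; the result has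
  the convolution shape required by \<open>has_egf_mult\<close>.\<close>

lemma card_first_section_arrangements_Suc:
  assumes A: "finite A"
  shows "real (card (first_section_arrangements \<gamma> \<beta> (Suc k) A)) =
    (\<Sum>B\<in>Pow A. (if B = {} then 0 else real \<beta> ^ card B) *
      real (card (first_section_arrangements \<gamma> \<beta> k (A - B))))"
proof -
  let ?S = "first_section_arrangements \<gamma> \<beta> (Suc k) A"
  let ?part = "\<lambda>f. {x \<in> A. \<exists>b. f x = Inr (Suc k, b)}"
  have "card ?S = (\<Sum>B\<in>Pow A. card {f \<in> ?S. ?part f = B})"
    using sum.group[of ?S "Pow A" ?part "\<lambda>_. 1::nat"] A finite_first_section_arrangements[OF A]
    by (auto simp: image_subset_iff)
  also have "real \<dots> = (\<Sum>B\<in>Pow A. (if B = {} then 0 else real \<beta> ^ card B) *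
      real (card (first_section_arrangements \<gamma> \<beta> k (A - B))))"
    unfolding of_nat_sum
  proof (rule sum.cong[OF refl])
    fix B assume "B \<in> Pow A"
    then have BA: "B \<subseteq> A" by simp
    show "real (card {f \<in> ?S. ?part f = B}) = (if B = {} then 0 else real \<beta> ^ card B) *
      real (card (first_section_arrangements \<gamma> \<beta> k (A - B)))"
    proof (cases "B = {}")
      case True
      \<comment> \<open>The last part may not be empty, so the fibre over the empty set is empty,
        matching the weight 0.\<close>
      have "?part f \<noteq> {}" if "f \<in> ?S" for f
      proof -
        have "Suc k \<in> {1..Suc k}" by simp
        then show ?thesis using that unfolding first_section_arrangements_def by blast
      qed
      then have none: "{f \<in> ?S. ?part f = B} = {}" using True by blast
      show ?thesis unfolding none using True by simp
    next
      case False
      have "finite B" using A BA by (rule rev_finite_subset)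
      then show ?thesis
        using bij_betw_same_card[OF fibre_first_section_arrangements[OF BA False], of \<beta> \<gamma> k, symmetric] False
        by (simp add: card_cartesian_product card_PiE)
    qed
  qed
  finally show ?thesis .
qed

lemma has_egf_first_section_arrangements:
  "has_egf (\<lambda>A. real (card (first_section_arrangements \<gamma> \<beta> k A)))
    (fps_exp (real \<gamma>) * (fps_exp (real \<beta>) - 1) ^ k)"
proof (induction k)
  case 0
  have c: "card (compartments \<gamma> \<beta> 0) = \<gamma>"
    by (simp add: compartments_def card_Plus)
  show ?case
    unfolding power_0 mult_1_right
    by (rule has_egf_cong[OF _ has_egf_power_card])
       (auto simp: first_section_arrangements_def card_PiE c)
next
  case (Suc k)
  show ?case
    using has_egf_cong[OF card_first_section_arrangements_Suc
      has_egf_mult[OF has_egf_power_card_nonempty Suc.IH]]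
    by (simp add: mult_ac)
qed

section \<open>The other sections\<close>

lemma preferential_arrangements_empty: "preferential_arrangements {} = {[]}"
proof -
  have "Bs = []" if "Bs \<in> preferential_arrangements {}" for Bs :: "'a set list"
    using that by (cases Bs) (auto simp: preferential_arrangements_def partition_on_def)
  then show ?thesis
    by (auto simp: preferential_arrangements_def partition_on_def)
qed

text \<open>Distinctness and the partition property together make the first block disjoint from all
  later ones. Conversely, a non-empty set disjoint from the later blocks cannot recur among them, so
  distinctness survives.\<close>

lemma Cons_in_preferential_arrangements_iff:
  "B # Bs \<in> preferential_arrangements X \<longleftrightarrow>
    B \<noteq> {} \<and> B \<subseteq> X \<and> Bs \<in> preferential_arrangements (X - B)"
proof
  assume "B # Bs \<in> preferential_arrangements X"
  then have d: "B \<notin> set Bs" "distinct Bs" and p: "partition_on X (insert B (set Bs))"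
    by (auto simp: preferential_arrangements_def)
  have "B \<inter> C = {}" if "C \<in> set Bs" for C
    using p d that by (auto simp: partition_on_def disjoint_def)
  then show "B \<noteq> {} \<and> B \<subseteq> X \<and> Bs \<in> preferential_arrangements (X - B)"
    using p d by (auto simp: preferential_arrangements_def partition_on_def disjoint_def)
next
  assume "B \<noteq> {} \<and> B \<subseteq> X \<and> Bs \<in> preferential_arrangements (X - B)"
  then have B: "B \<noteq> {}" "B \<subseteq> X" and d: "distinct Bs" and p: "partition_on (X - B) (set Bs)"
    by (auto simp: preferential_arrangements_def)
  have "C \<subseteq> X - B" "C \<noteq> {}" if "C \<in> set Bs" for C
    using p that by (auto simp: partition_on_def)
  then have "B \<inter> C = {}" "C \<noteq> {}" if "C \<in> set Bs" for C
    using that by auto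
  moreover from this have "B \<notin> set Bs" using B by auto
  ultimately show "B # Bs \<in> preferential_arrangements X"
    using B d p by (auto simp: preferential_arrangements_def partition_on_def disjoint_def)
qed

text \<open>A non-empty set has a first block; removing it leaves a proper subset, so this recursion
  is well founded.\<close>

lemma card_preferential_arrangements_rec:
  assumes X: "finite X" "X \<noteq> {}"
  shows "card (preferential_arrangements X) =
    (\<Sum>B\<in>Pow X - {{}}. card (preferential_arrangements (X - B)))"
proof -
  have ne: "Bs \<noteq> []" if "Bs \<in> preferential_arrangements X" for Bs
    using that X by (auto simp: preferential_arrangements_def partition_on_def)
  have "preferential_arrangements X =
      (\<lambda>(B, Bs). B # Bs) ` (SIGMA B:Pow X - {{}}. preferential_arrangements (X - B))" (is "_ = ?f ` ?S")
  proof (intro equalityI subsetI)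
    fix Bs assume "Bs \<in> preferential_arrangements X"
    with ne[OF this] show "Bs \<in> ?f ` ?S"
      by (cases Bs) (auto simp: Cons_in_preferential_arrangements_iff image_iff)
  qed (auto simp: Cons_in_preferential_arrangements_iff)
  moreover have "inj_on ?f ?S" by (auto simp: inj_on_def)
  ultimately have "card (preferential_arrangements X) = card ?S"
    by (simp add: card_image)
  also have "\<dots> = (\<Sum>B\<in>Pow X - {{}}. card (preferential_arrangements (X - B)))"
    using X by (intro card_SigmaI) (auto intro: finite_preferential_arrangements)
  finally show ?thesis .
qed

text \<open>The labels contribute a factor \<open>real \<beta> ^ card A\<close>, which splits along
  the first block. The recursion for the counts thus becomes the functional equation of
  \<open>G\<close>, and induction over proper subsets identifies the coefficients.\<close>

lemma has_egf_other_section_arrangements: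
  "has_egf (\<lambda>A. real (card (other_section_arrangements \<beta> A))) (inverse (2 - fps_exp (real \<beta>)))"
proof -
  let ?E = "fps_exp (real \<beta>)"
  let ?w = "\<lambda>A. real (card (other_section_arrangements \<beta> A))"
  define G where "G = inverse (2 - ?E)"
  have c0: "fps_nth (2 - ?E) 0 = 1"
    by simp
  then have "G * (2 - ?E) = 1"
    unfolding G_def by (intro inverse_mult_eq_1) simp
  \<comment> \<open>This rearranges the inverse property, using
    \<open>2 - ?E = 1 - (?E - 1)\<close>.\<close>
  then have G: "G = 1 + (?E - 1) * G"
    by (simp add: algebra_simps)
  have w: "?w A = real (card (preferential_arrangements A)) * real \<beta> ^ card A" if "finite A" for A :: "'a set"
    using that by (simp add: other_section_arrangements_def card_cartesian_product card_PiE)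
  have "?w A = fact (card A) * fps_nth G (card A)" if "finite A" for A :: "'a set"
    using that
  proof (induction rule: finite_psubset_induct)
    case (psubset X)
    show ?case
    proof (cases "X = {}")
      case True
      then show ?thesis
        using c0 by (simp add: w preferential_arrangements_empty G_def)
    next
      case False
      have "?w X = (\<Sum>B\<in>Pow X - {{}}. real (card (preferential_arrangements (X - B))) * real \<beta> ^ card X)"
        using psubset.hyps False
        by (simp add: w card_preferential_arrangements_rec sum_distrib_right)
      also have "\<dots> = (\<Sum>B\<in>Pow X - {{}}. real \<beta> ^ card B * ?w (X - B))"
      proof (rule sum.cong[OF refl])
        fix B assume "B \<in> Pow X - {{}}"
        then have "B \<subseteq> X" by auto
        then have "card X = card B + card (X - B)"
          using psubset.hyps by (metis card_Diff_subset card_mono finite_subset le_add_diff_inverse)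
        then show "real (card (preferential_arrangements (X - B))) * real \<beta> ^ card X
            = real \<beta> ^ card B * ?w (X - B)"
          using psubset.hyps by (simp add: w power_add)
      qed
      \<comment> \<open>Weight 0 at \<open>B = {}\<close> lets the sum run over all subsets and
        suppresses the term containing the still unknown \<open>?w X\<close>.\<close>
      also have "\<dots> = (\<Sum>B\<in>Pow X. (if B = {} then 0 else real \<beta> ^ card B) * ?w (X - B))"
        using psubset.hyps by (intro sum.mono_neutral_cong_left) auto
      also have "\<dots> = fact (card X) * fps_nth ((?E - 1) * G) (card X)"
      proof (rule sum_Pow_egf_mult[OF psubset.hyps])
        fix B assume B: "B \<subseteq> X"
        show "(if B = {} then 0 else real \<beta> ^ card B) * ?w (X - B) =
          (fact (card B) * fps_nth (?E - 1) (card B)) * (fact (card (X - B)) * fps_nth G (card (X - B)))"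
        proof (cases "B = {}")
          case False
          have "finite B" using B psubset.hyps by (rule finite_subset)
          moreover have "X - B \<subset> X" using B False by auto
          ultimately show ?thesis
            using psubset.IH has_egfD[OF has_egf_power_card_nonempty, of B "real \<beta>"] by simp
        qed simp
      qed
      \<comment> \<open>As \<open>X\<close> is non-empty, the summand 1 in the equation for
        \<open>G\<close> does not affect this coefficient.\<close>
      also have "fps_nth ((?E - 1) * G) (card X) = fps_nth G (card X)"
        using psubset.hyps False by (subst (2) G) simp
      finally show ?thesis .
    qed
  qed
  then show ?thesis
    unfolding has_egf_def G_def by blast
qed

section \<open>Distributing the elements among the sections\<close>

text \<open>Counting sections instead of bars admits \<open>m = 0\<close>, which is the base case
  for induction and describes what follows the first section when there are no bars.\<close>

definition section_lists :: "nat \<Rightarrow> 'a set \<Rightarrow> 'a set list set" where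
  "section_lists m X =
     {Ss. length Ss = m \<and> disjoint_family_on (nth Ss) {..<length Ss} \<and> \<Union>(set Ss) = X}"

lemma barred_sections_eq: "barred_sections \<xi> X = section_lists (Suc \<xi>) X"
  by (simp add: barred_sections_def section_lists_def)

lemma finite_section_lists:
  assumes "finite X"
  shows "finite (section_lists m X)"
proof (rule finite_subset)
  show "section_lists m X \<subseteq> {Ss. set Ss \<subseteq> Pow X \<and> length Ss = m}"
    by (auto simp: section_lists_def)
  show "finite {Ss. set Ss \<subseteq> Pow X \<and> length Ss = m}"
    using assms by (intro finite_lists_length_eq) auto
qed

lemma disjoint_family_on_nth_Cons:
  "disjoint_family_on (nth (A # Ss)) {..<length (A # Ss)} \<longleftrightarrow>
    A \<inter> \<Union>(set Ss) = {} \<and> disjoint_family_on (nth Ss) {..<length Ss}"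
proof -
  have "{..<length (A # Ss)} = insert 0 (Suc ` {..<length Ss})"
    by (simp add: lessThan_Suc_eq_insert_0)
  moreover have "\<Union>(set Ss) = (\<Union>i<length Ss. Ss ! i)"
    by (auto simp: set_conv_nth)
  moreover have "disjoint_family_on (nth (A # Ss)) (Suc ` {..<length Ss}) \<longleftrightarrow>
      disjoint_family_on (nth Ss) {..<length Ss}"
    by (auto simp: disjoint_family_on_def)
  ultimately show ?thesis
    by (simp add: disjoint_family_on_insert)
qed

lemma Cons_in_section_lists_iff:
  "A # Ss \<in> section_lists (Suc m) X \<longleftrightarrow> A \<subseteq> X \<and> Ss \<in> section_lists m (X - A)"
  unfolding section_lists_def mem_Collect_eq disjoint_family_on_nth_Cons by auto

text \<open>Stated for arbitrary \<open>h\<close> because it serves twice: to peel off equal factors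
  one by one, and to separate the first section from the others.\<close>

lemma sum_section_lists_Suc:
  fixes h :: "'a set list \<Rightarrow> real"
  assumes X: "finite X"
  shows "(\<Sum>Ss\<in>section_lists (Suc m) X. h Ss) =
    (\<Sum>A\<in>Pow X. \<Sum>Ss\<in>section_lists m (X - A). h (A # Ss))"
proof -
  have "section_lists (Suc m) X =
      (\<lambda>(A, Ss). A # Ss) ` (SIGMA A:Pow X. section_lists m (X - A))" (is "_ = ?f ` ?S")
  proof (intro equalityI subsetI)
    fix Ss assume Ss: "Ss \<in> section_lists (Suc m) X"
    then obtain A Ts where "Ss = A # Ts"
      by (auto simp: section_lists_def length_Suc_conv)
    with Ss show "Ss \<in> ?f ` ?S"
      by (auto simp: Cons_in_section_lists_iff image_iff)
  qed (auto simp: Cons_in_section_lists_iff)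
  moreover have "inj_on ?f ?S" by (auto simp: inj_on_def)
  ultimately have "(\<Sum>Ss\<in>section_lists (Suc m) X. h Ss) = (\<Sum>(A, Ss)\<in>?S. h (A # Ss))"
    by (simp add: sum.reindex case_prod_unfold)
  also have "\<dots> = (\<Sum>A\<in>Pow X. \<Sum>Ss\<in>section_lists m (X - A). h (A # Ss))"
    using X by (intro sum.Sigma[symmetric]) (auto intro: finite_section_lists)
  finally show ?thesis .
qed

lemma has_egf_sum_section_lists:
  assumes "has_egf w F"
  shows "has_egf (\<lambda>X. \<Sum>Ss\<in>section_lists m X. prod_list (map w Ss)) (F ^ m)"
proof (induction m)
  case 0
  \<comment> \<open>Without sections only the empty set can be covered, so the weight is the
    indicator of \<open>X = {}\<close>, with generating function 1.\<close>
  have "section_lists 0 X = (if X = {} then {[]} else {})" for X :: "'a set"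
    by (auto simp: section_lists_def disjoint_family_on_def)
  then show ?case
    by (auto simp: has_egf_def)
next
  case (Suc m)
  show ?case
    unfolding power_Suc
    by (rule has_egf_cong[OF _ has_egf_mult[OF assms Suc.IH]])
       (simp add: sum_section_lists_Suc sum_distrib_left)
qed

lemma card_list_all2:
  assumes "\<And>x. x \<in> set xs \<Longrightarrow> finite {y. P x y}"
  shows "card {ys. list_all2 P xs ys} = prod_list (map (\<lambda>x. card {y. P x y}) xs)"
  using assms
proof (induction xs)
  case Nil
  have "{ys. list_all2 P [] ys} = {[]}" by auto
  then show ?case by simp
next
  case (Cons x xs)
  have "{ys. list_all2 P (x # xs) ys} =
      (\<lambda>(y, ys). y # ys) ` ({y. P x y} \<times> {ys. list_all2 P xs ys})"
    by (auto simp: list_all2_Cons1)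
  moreover have "inj_on (\<lambda>(y, ys). y # ys) ({y. P x y} \<times> {ys. list_all2 P xs ys})"
    by (auto simp: inj_on_def)
  ultimately show ?case
    using Cons by (simp add: card_image card_cartesian_product)
qed

lemma finite_other_section_arrangements:
  "finite A \<Longrightarrow> finite (other_section_arrangements \<beta> A)"
  unfolding other_section_arrangements_def
  by (intro finite_cartesian_product finite_preferential_arrangements finite_PiE) auto

text \<open>The first section has its own structure and is split off; given the section list, all
  remaining choices are independent. Again the outcome is a convolution.\<close>

lemma card_barred_arrangements:
  assumes X: "finite X"
  shows "real (card (barred_arrangements \<xi> \<beta> \<gamma> k X)) =
    (\<Sum>A\<in>Pow X. real (card (first_section_arrangements \<gamma> \<beta> k A)) *
      (\<Sum>Ss\<in>section_lists \<xi> (X - A).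
        prod_list (map (\<lambda>A. real (card (other_section_arrangements \<beta> A))) Ss)))"
proof -
  let ?P = "\<lambda>A g. g \<in> other_section_arrangements \<beta> A"
  let ?F = "\<lambda>Ss. first_section_arrangements \<gamma> \<beta> k (hd Ss) \<times> {gs. list_all2 ?P (tl Ss) gs}"
  have fin: "finite A" if "Ss \<in> section_lists m Y" "A \<in> set Ss" "Y \<subseteq> X" for Ss A m Y
    using that X by (auto simp: section_lists_def intro: finite_subset)
  have F: "finite (?F Ss)" if Ss: "Ss \<in> section_lists (Suc \<xi>) X" for Ss
  proof -
    have "Ss \<noteq> []" using Ss by (auto simp: section_lists_def)
    then have "finite A" if "A = hd Ss \<or> A \<in> set (tl Ss)" for A
      using that fin[OF Ss] by (meson list.set_sel subset_refl)
    then show ?thesis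
      by (intro finite_cartesian_product finite_list_all2_image)
         (auto intro: finite_first_section_arrangements finite_other_section_arrangements)
  qed
  have "barred_arrangements \<xi> \<beta> \<gamma> k X = Sigma (section_lists (Suc \<xi>) X) ?F"
    by (auto simp: barred_arrangements_def barred_sections_eq)
  then have "real (card (barred_arrangements \<xi> \<beta> \<gamma> k X)) =
      (\<Sum>Ss\<in>section_lists (Suc \<xi>) X. real (card (?F Ss)))"
    using F X by (simp add: finite_section_lists)
  also have "\<dots> = (\<Sum>A\<in>Pow X. \<Sum>Ss\<in>section_lists \<xi> (X - A).
      real (card (first_section_arrangements \<gamma> \<beta> k A)) * real (card {gs. list_all2 ?P Ss gs}))"
    by (simp add: sum_section_lists_Suc[OF X] card_cartesian_product)
  also have "\<dots> = (\<Sum>A\<in>Pow X. real (card (first_section_arrangements \<gamma> \<beta> k A)) *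
      (\<Sum>Ss\<in>section_lists \<xi> (X - A).
        prod_list (map (\<lambda>A. real (card (other_section_arrangements \<beta> A))) Ss)))"
    unfolding sum_distrib_left
  proof (intro sum.cong refl)
    fix A Ss assume Ss: "Ss \<in> section_lists \<xi> (X - A)"
    have "card {gs. list_all2 ?P Ss gs} = prod_list (map (\<lambda>A. card (other_section_arrangements \<beta> A)) Ss)"
      using card_list_all2[of Ss ?P] fin[OF Ss] by (auto intro: finite_other_section_arrangements)
    moreover have "real (prod_list ns) = prod_list (map real ns)" for ns
      by (induction ns) auto
    ultimately show "real (card (first_section_arrangements \<gamma> \<beta> k A)) * real (card {gs. list_all2 ?P Ss gs}) =
      real (card (first_section_arrangements \<gamma> \<beta> k A)) *
        prod_list (map (\<lambda>A. real (card (other_section_arrangements \<beta> A))) Ss)"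
      by (simp add: comp_def)
  qed
  finally show ?thesis .
qed

section \<open>The product of the generating functions and its binomial expansion\<close>

lemma has_egf_barred_arrangements:
  "has_egf (\<lambda>X. real (card (barred_arrangements \<xi> \<beta> \<gamma> k X)))
    (fps_exp (real \<gamma>) * (fps_exp (real \<beta>) - 1) ^ k * inverse (2 - fps_exp (real \<beta>)) ^ \<xi>)"
  by (rule has_egf_cong[OF card_barred_arrangements has_egf_mult[OF has_egf_first_section_arrangements
    has_egf_sum_section_lists[OF has_egf_other_section_arrangements]]])

text \<open>The denominator has constant term \<open>2 - 1 = 1\<close>, hence the quotient is a
  product with an inverse series.\<close>

lemma H_eq:
  "H n m \<beta> \<gamma> = fact n * fps_nth (fps_exp (real \<gamma>) * inverse (2 - fps_exp (real \<beta>)) ^ m) n"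
  by (simp add: H_def fps_divide_unit fps_inverse_power fps_nth_power_0)

text \<open>The binomial theorem produces the signs, and merging the exponentials produces the
  exponents \<open>\<gamma> + \<beta> * s\<close> that become the last argument of
  \<open>H\<close>.\<close>

lemma fps_exp_mult_minus_one_power:
  "fps_exp (real \<gamma>) * (fps_exp (real \<beta>) - 1) ^ k =
    (\<Sum>s=0..k. fps_const ((- 1) ^ (k - s) * real (k choose s)) * fps_exp (real (\<gamma> + \<beta> * s)))"
proof -
  have "(fps_exp (real \<beta>) - 1) ^ k =
      (\<Sum>s=0..k. of_nat (k choose s) * fps_exp (real \<beta>) ^ s * (- 1) ^ (k - s))"
    using binomial_ring[of "fps_exp (real \<beta>)" "- 1" k] by (simp add: atLeast0AtMost)
  then show ?thesis
    \<comment> \<open>The rules for constant series run backwards, splitting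
      \<open>fps_const\<close> over products, powers and negation, so that both sides become
      products of the same factors.\<close>
    by (simp add: sum_distrib_left fps_exp_add_mult fps_exp_power_mult fps_const_mult[symmetric]
        fps_of_nat[symmetric] fps_const_power[symmetric] fps_const_neg[symmetric] mult_ac
        del: fps_const_mult fps_const_power fps_const_neg)
qed

lemma card_barred_arrangements_eq_sum_H:
  "real (card (barred_arrangements \<xi> \<beta> \<gamma> k {1..n})) =
    (\<Sum>s=0..k. (- 1) ^ (k - s) * real (k choose s) * H n \<xi> \<beta> (\<gamma> + \<beta> * s))"
  using has_egfD[OF has_egf_barred_arrangements, of "{1..n}" \<xi> \<beta> \<gamma> k]
  \<comment> \<open>The casts of \<open>\<gamma> + \<beta> * s\<close> are kept intact so that they
    match the form given by \<open>H_eq\<close>.\<close>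
  by (simp add: fps_exp_mult_minus_one_power H_eq sum_distrib_right sum_distrib_left fps_sum_nth
      mult.assoc mult.left_commute[of "fact n"] del: of_nat_add of_nat_mult)

theorem theorem13:
  fixes \<gamma> n \<beta> l :: nat
  assumes "\<beta> \<ge> 1" and "l \<ge> 1"
  shows "real (\<Sum>k=0..n. card (barred_arrangements (l - 1) \<beta> \<gamma> k {1..n})) =
    (\<Sum>k=0..n. \<Sum>s=0..k. (- 1) ^ (k - s) * real (k choose s) * H n (l - 1) \<beta> (\<gamma> + \<beta> * s))"
  by (simp only: of_nat_sum card_barred_arrangements_eq_sum_H)

end
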